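(* Let $n\ge1$ and $m=(m_1,\dots,m_n)\in\mathbb Z^n$. For $k=1,\dots,n$ put $L_k=\sigma_k\big(\frac{\partial^2}{\partial x_1^2},\dots,\frac{\partial^2}{\partial x_n^2}\big)$. (i) The function $\sin^-_m$ satisfies $L_k\sin^-_m=(-4\pi^2)^k\sigma_k(m_1^2,\dots,m_n^2)\sin^-_m$ on $F$ for $k=1,\dots,n$, and the Dirichlet boundary condition $\sin^-_m(x)=0$ for all $x\in\partial F$. (ii) The function $\cos^+_m$ satisfies $L_k\cos^+_m=(-4\pi^2)^k\sigma_k(m_1^2,\dots,m_n^2)\cos^+_m$ on $F$ for $k=1,\dots,n$, and the Neumann boundary condition $\frac{\partial \cos^+_m}{\partial\mathbf n}(x)=0$ for all $x\in\partial F$.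
   Context: $F=\{x\in\mathbb R^n:\ \tfrac12>x_1>x_2>\cdots>x_n>0\}$. Its boundary $\partial F$ is the union of walls, which are the sets of points of the closure $\overline F$ lying on one of the hyperplanes $x_1=\frac12$, $x_i=x_{i+1}$ ($1\le i\le n-1$), $x_n=0$. The condition $\partial g/\partial\mathbf n=0$ on $\partial F$ means that at every point of each wall the derivative of $g$ in the direction normal to the hyperplane of that wall is zero. $\sin^-_m(x)=\det(\sin2\pi m_ix_j)_{i,j=1}^n$ and $\cos^+_m(x)=\sum_{w\in S_n}\prod_{j=1}^n\cos(2\pi m_{w(j)}x_j)$, with $S_n$ the symmetric group. $\sigma_k$ is the $k$-th elementary symmetric polynomial in $n$ variables; $L_1$ is the Laplace operator. *)

theory Defs
  imports "HOL-Analysis.Analysis"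
begin

text \<open>
  Points of n-dimensional space are vectors over a finite linearly ordered index type, whose
  elements in increasing order play the role of 1, ..., n.
\<close>

abbreviation first_index :: "'n::{finite,linorder}"
  where "first_index \<equiv> Min UNIV"

abbreviation last_index :: "'n::{finite,linorder}"
  where "last_index \<equiv> Max UNIV"

definition consecutive :: "'n::linorder \<Rightarrow> 'n \<Rightarrow> bool"
  where "consecutive i j \<longleftrightarrow> i < j \<and> \<not> (\<exists>k. i < k \<and> k < j)"

definition fund_domain :: "(real ^ 'n::{finite,linorder}) set"
  where "fund_domain =
    {x. 1 / 2 > x $ first_index \<and> (\<forall>i j. consecutive i j \<longrightarrow> x $ i > x $ j) \<and> x $ last_index > 0}"

text \<open>
  A pair \<open>(a, b)\<close> stands for the hyperplane with equation \<open>a \<bullet> x = b\<close>, which has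
  the unit normal vector \<open>sgn a\<close>.
\<close>

definition wall_equations :: "((real ^ 'n::{finite,linorder}) \<times> real) set"
  where "wall_equations =
    {(axis first_index 1, 1 / 2)} \<union>
    {(axis i 1 - axis j 1, 0) | i j. consecutive i j} \<union>
    {(axis last_index 1, 0)}"

definition wall :: "real ^ 'n::{finite,linorder} \<Rightarrow> real \<Rightarrow> (real ^ 'n::{finite,linorder}) set"
  where "wall a b = closure fund_domain \<inter> {x. a \<bullet> x = b}"

definition dirichlet :: "(real ^ 'n::{finite,linorder} \<Rightarrow> real) \<Rightarrow> bool"
  where "dirichlet g \<longleftrightarrow> (\<forall>x \<in> frontier fund_domain. g x = 0)"

text \<open>
  At a point on several walls, the normal derivative has to vanish for each of them.
\<close>

definition neumann :: "(real ^ 'n::{finite,linorder} \<Rightarrow> real) \<Rightarrow> bool"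
  where "neumann g \<longleftrightarrow>
    (\<forall>(a, b) \<in> wall_equations. \<forall>x \<in> wall a b.
      ((\<lambda>t. g (x + t *\<^sub>R sgn a)) has_real_derivative 0) (at 0))"

definition sin_minus :: "int ^ 'n::finite \<Rightarrow> real ^ 'n \<Rightarrow> real"
  where "sin_minus m x = det (\<chi> i j. sin (2 * pi * of_int (m $ i) * x $ j))"

definition cos_plus :: "int ^ 'n::finite \<Rightarrow> real ^ 'n \<Rightarrow> real"
  where "cos_plus m x =
    (\<Sum>w | w permutes UNIV. \<Prod>j\<in>UNIV. cos (2 * pi * of_int (m $ w j) * x $ j))"

definition elem_sym :: "nat \<Rightarrow> ('n::finite \<Rightarrow> real) \<Rightarrow> real"
  where "elem_sym k a = (\<Sum>S | card S = k. \<Prod>i\<in>S. a i)"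

definition partial_deriv ::
    "'n::finite \<Rightarrow> (real ^ 'n \<Rightarrow> real) \<Rightarrow> real ^ 'n \<Rightarrow> real"
  where "partial_deriv i g x = deriv (\<lambda>t. g (x + t *\<^sub>R axis i 1)) 0"

text \<open>
  The operator obtained by substituting the second partial derivatives for the variables of the
  k-th elementary symmetric polynomial. Products of operators are compositions; since these
  commute only on sufficiently smooth functions, a fixed order (that of the indices) is used.
\<close>

definition diff_op_L ::
    "nat \<Rightarrow> (real ^ 'n::{finite,linorder} \<Rightarrow> real) \<Rightarrow> real ^ 'n::{finite,linorder} \<Rightarrow> real"
  where "diff_op_L k g x =
    (\<Sum>S | card S = k.
      foldr (\<lambda>i h. partial_deriv i (partial_deriv i h)) (sorted_list_of_set S) g x)"

text \<open>The topological boundary is the union of the walls.\<close>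

lemma frontier_fund_domain:
  "frontier (fund_domain :: (real ^ 'n::{finite,linorder}) set) =
    (\<Union>(a, b) \<in> wall_equations. wall a b)"
proof -
  let ?C = "{x :: (real, 'n) vec. x $ first_index \<le> 1 / 2} \<inter>
    (\<Inter>i. \<Inter>j\<in>{j. consecutive i j}. {x. x $ j \<le> x $ i}) \<inter> {x. 0 \<le> x $ last_index}"
  let ?O = "{x :: (real, 'n) vec. x $ first_index < 1 / 2} \<inter>
    (\<Inter>i. \<Inter>j\<in>{j. consecutive i j}. {x. x $ j < x $ i}) \<inter> {x. 0 < x $ last_index}"
  have F: "fund_domain = ?O"
    by (auto simp: fund_domain_def)
  have "open ?O"
    by (intro open_Int open_INT finite ballI open_Collect_less continuous_intros)
  then have int: "interior fund_domain = (fund_domain :: (real, 'n) vec set)"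
    using F by (simp add: interior_open)
  have "closed ?C"
    by (intro closed_Int closed_INT ballI closed_Collect_le continuous_intros)
  moreover have "fund_domain \<subseteq> ?C"
    unfolding F by (auto simp: less_imp_le)
  ultimately have cl: "closure fund_domain \<subseteq> ?C"
    by (rule closure_minimal[rotated])
  have "x \<notin> fund_domain \<longleftrightarrow> (\<exists>(a, b) \<in> wall_equations. a \<bullet> x = b)"
    if x: "x \<in> closure fund_domain" for x :: "(real, 'n) vec"
  proof -
    have "x \<in> ?C"
      using x cl by blast
    then have "x \<notin> fund_domain \<longleftrightarrow>
        x $ first_index = 1 / 2 \<or> (\<exists>i j. consecutive i j \<and> x $ i = x $ j) \<or> x $ last_index = 0"
      unfolding fund_domain_def by (force simp: not_less)
    also have "\<dots> \<longleftrightarrow> (\<exists>(a, b) \<in> wall_equations. a \<bullet> x = b)"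
      unfolding wall_equations_def
      by (auto simp: inner_axis' inner_diff_left bex_Un)
    finally show ?thesis .
  qed
  then show ?thesis
    unfolding frontier_def int wall_def by blast
qed

end

(*
  Expanding the determinant over permutations, both functions are linear combinations, indexed by
  permutations w, of products of one-variable functions f (2 pi m_w(j) x_j) with f'' = - f. Each
  product is a common eigenfunction of all the second partial derivatives, and a symmetric
  polynomial in their eigenvalues does not depend on w.

  On a wall, the determinant has a zero column or two equal columns. The cosine function is
  invariant under the reflection in each wall, so it is even along the normal line through a point
  of the wall, and its derivative there vanishes.
*)

theory Submission
  imports Defs
begin

section \<open>Differential operators on sums of products of one-variable functions\<close>

text \<open>Only the \<open>i\<close>-th factor of each product depends on the \<open>i\<close>-th
  coordinate. The function update keeps the result in the shape of the original sum, so that the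
  rule can be applied a second time.\<close>

lemma partial_deriv_sum_prod:
  fixes c :: "'w \<Rightarrow> real" and \<phi> :: "'w \<Rightarrow> 'n::finite \<Rightarrow> real \<Rightarrow> real"
  assumes "\<And>w t. w \<in> W \<Longrightarrow> (\<phi> w i has_real_derivative \<psi> w t) (at t)"
  shows "partial_deriv i (\<lambda>x. \<Sum>w\<in>W. c w * (\<Prod>j\<in>UNIV. \<phi> w j (x $ j))) =
    (\<lambda>x. \<Sum>w\<in>W. c w * (\<Prod>j\<in>UNIV. ((\<phi> w)(i := \<psi> w)) j (x $ j)))"
proof
  fix x :: "real ^ 'n"
  have split: "(\<Prod>j\<in>UNIV. h j) = h i * (\<Prod>j\<in>UNIV - {i}. h j)" for h :: "'n \<Rightarrow> real"
    by (rule prod.remove) auto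
  have eq: "(\<Prod>j\<in>UNIV. \<phi> w j ((x + t *\<^sub>R axis i 1) $ j)) =
      \<phi> w i (x $ i + t) * (\<Prod>j\<in>UNIV - {i}. \<phi> w j (x $ j))" for w t
    unfolding split by (auto simp: axis_def intro!: prod.cong)
  have "((\<lambda>t. \<phi> w i (x $ i + t)) has_real_derivative \<psi> w (x $ i)) (at 0)" if "w \<in> W" for w
    using DERIV_at_within_shift[of "\<phi> w i" "\<psi> w (x $ i)" "x $ i" 0 UNIV] assms[OF that, of "x $ i"]
    by simp
  then have "((\<lambda>t. \<Sum>w\<in>W. c w * (\<Prod>j\<in>UNIV. \<phi> w j ((x + t *\<^sub>R axis i 1) $ j)))
      has_real_derivative (\<Sum>w\<in>W. c w * (\<psi> w (x $ i) * (\<Prod>j\<in>UNIV - {i}. \<phi> w j (x $ j))))) (at 0)"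
    unfolding eq by (intro DERIV_sum DERIV_cmult DERIV_cmult_right)
  moreover have "(\<Prod>j\<in>UNIV. ((\<phi> w)(i := \<psi> w)) j (x $ j)) =
      \<psi> w (x $ i) * (\<Prod>j\<in>UNIV - {i}. \<phi> w j (x $ j))" for w
    unfolding split by (auto intro!: prod.cong)
  ultimately show "partial_deriv i (\<lambda>x. \<Sum>w\<in>W. c w * (\<Prod>j\<in>UNIV. \<phi> w j (x $ j))) x =
      (\<Sum>w\<in>W. c w * (\<Prod>j\<in>UNIV. ((\<phi> w)(i := \<psi> w)) j (x $ j)))"
    unfolding partial_deriv_def by (auto dest: DERIV_imp_deriv)
qed

text \<open>The eigenvalue is moved into the coefficient \<open>c\<close>, so the outcome is again a
  sum of the same products and the rule can be iterated.\<close>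

lemma second_partial_deriv_sum_prod:
  fixes c :: "'w \<Rightarrow> real" and \<phi> \<psi> :: "'w \<Rightarrow> 'n::finite \<Rightarrow> real \<Rightarrow> real"
  assumes "\<And>w j t. w \<in> W \<Longrightarrow> (\<phi> w j has_real_derivative \<psi> w j t) (at t)"
    and "\<And>w j t. w \<in> W \<Longrightarrow> (\<psi> w j has_real_derivative \<mu> w j * \<phi> w j t) (at t)"
  shows "partial_deriv i (partial_deriv i (\<lambda>x. \<Sum>w\<in>W. c w * (\<Prod>j\<in>UNIV. \<phi> w j (x $ j)))) =
    (\<lambda>x. \<Sum>w\<in>W. (\<mu> w i * c w) * (\<Prod>j\<in>UNIV. \<phi> w j (x $ j)))"
proof -
  let ?\<phi>' = "\<lambda>w. (\<phi> w)(i := \<psi> w i)"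
  have "partial_deriv i (\<lambda>x. \<Sum>w\<in>W. c w * (\<Prod>j\<in>UNIV. \<phi> w j (x $ j))) =
      (\<lambda>x. \<Sum>w\<in>W. c w * (\<Prod>j\<in>UNIV. ?\<phi>' w j (x $ j)))"
    by (rule partial_deriv_sum_prod) (rule assms(1))
  moreover have "partial_deriv i (\<lambda>x. \<Sum>w\<in>W. c w * (\<Prod>j\<in>UNIV. ?\<phi>' w j (x $ j))) =
      (\<lambda>x. \<Sum>w\<in>W. c w * (\<Prod>j\<in>UNIV. ((?\<phi>' w)(i := \<lambda>t. \<mu> w i * \<phi> w i t)) j (x $ j)))"
    by (rule partial_deriv_sum_prod) (simp add: assms(2))
  moreover have "(\<Prod>j\<in>UNIV. ((?\<phi>' w)(i := \<lambda>t. \<mu> w i * \<phi> w i t)) j (x $ j)) =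
      \<mu> w i * (\<Prod>j\<in>UNIV. \<phi> w j (x $ j))" for w and x :: "real ^ 'n"
    by (simp add: prod.remove[of UNIV i])
  ultimately show ?thesis
    by (simp add: mult_ac)
qed

text \<open>Each index set \<open>S\<close> multiplies a product by its eigenvalues over
  \<open>S\<close>; exchanging the sums over \<open>S\<close> and \<open>w\<close> collects these
  into \<open>elem_sym\<close>. The factor may still depend on \<open>w\<close>.\<close>

lemma diff_op_L_sum_prod:
  fixes c :: "'w \<Rightarrow> real" and \<phi> \<psi> :: "'w \<Rightarrow> 'n::{finite,linorder} \<Rightarrow> real \<Rightarrow> real"
  assumes "\<And>w j t. w \<in> W \<Longrightarrow> (\<phi> w j has_real_derivative \<psi> w j t) (at t)"
    and "\<And>w j t. w \<in> W \<Longrightarrow> (\<psi> w j has_real_derivative \<mu> w j * \<phi> w j t) (at t)"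
  shows "diff_op_L k (\<lambda>x. \<Sum>w\<in>W. c w * (\<Prod>j\<in>UNIV. \<phi> w j (x $ j))) x =
    (\<Sum>w\<in>W. elem_sym k (\<mu> w) * (c w * (\<Prod>j\<in>UNIV. \<phi> w j (x $ j))))"
proof -
  have fold: "foldr (\<lambda>i h. partial_deriv i (partial_deriv i h)) is
      (\<lambda>x. \<Sum>w\<in>W. c w * (\<Prod>j\<in>UNIV. \<phi> w j (x $ j))) =
    (\<lambda>x. \<Sum>w\<in>W. (prod_list (map (\<mu> w) is) * c w) * (\<Prod>j\<in>UNIV. \<phi> w j (x $ j)))" for "is"
  proof (induction "is")
    case (Cons i "is")
    show ?case
      \<comment> \<open>The eigenvalues gathered from the tail of the list count as part of the
        arbitrary coefficient.\<close>
      unfolding foldr.simps o_apply Cons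
      by (subst second_partial_deriv_sum_prod[where \<mu> = \<mu>, OF assms]) (simp_all add: mult.assoc)
  qed simp
  have "diff_op_L k (\<lambda>x. \<Sum>w\<in>W. c w * (\<Prod>j\<in>UNIV. \<phi> w j (x $ j))) x =
      (\<Sum>S | card S = k. \<Sum>w\<in>W. (\<Prod>i\<in>S. \<mu> w i) * (c w * (\<Prod>j\<in>UNIV. \<phi> w j (x $ j))))"
    unfolding diff_op_L_def fold by (simp add: prod.distinct_set_conv_list[symmetric] mult.assoc)
  also have "\<dots> = (\<Sum>w\<in>W. elem_sym k (\<mu> w) * (c w * (\<Prod>j\<in>UNIV. \<phi> w j (x $ j))))"
    unfolding elem_sym_def sum_distrib_right by (rule sum.swap)
  finally show ?thesis .
qed

text \<open>Taking images under \<open>w\<close> is a bijection of the family of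
  \<open>k\<close>-element subsets onto itself, and the sum is reindexed along it.\<close>

lemma elem_sym_permute:
  fixes a :: "'n::finite \<Rightarrow> real"
  assumes "w permutes UNIV"
  shows "elem_sym k (\<lambda>i. a (w i)) = elem_sym k a"
proof -
  have "bij w"
    using assms by (rule permutes_bij)
  then have inj: "inj w"
    by (rule bij_is_inj)
  have "inj_on ((`) w) {S. card S = k}"
    using inj by (simp add: inj_on_def inj_image_eq_iff)
  moreover have "(`) w ` {S. card S = k} = {S. card S = k}"
  proof (intro equalityI subsetI)
    fix S :: "'n set"
    assume S: "S \<in> {S. card S = k}"
    then have "inv w ` S \<in> {S. card S = k}"
      using bij_is_inj[OF bij_imp_bij_inv[OF \<open>bij w\<close>]] by (simp add: card_image inj_on_subset)
    moreover have "w ` inv w ` S = S"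
      using \<open>bij w\<close> by (simp add: image_image bij_is_surj surj_f_inv_f)
    ultimately show "S \<in> (`) w ` {S. card S = k}"
      by (metis imageI)
  qed (auto simp: card_image inj_on_subset[OF inj])
  ultimately have "bij_betw ((`) w) {S. card S = k} {S. card S = k}"
    by (simp add: bij_betw_def)
  then have "elem_sym k a = (\<Sum>S | card S = k. \<Prod>i\<in>w ` S. a i)"
    unfolding elem_sym_def by (rule sum.reindex_bij_betw[symmetric])
  also have "\<dots> = elem_sym k (\<lambda>i. a (w i))"
    unfolding elem_sym_def by (simp add: prod.reindex inj_on_subset[OF inj])
  finally show ?thesis ..
qed

lemma elem_sym_scale: "elem_sym k (\<lambda>i. c * a i) = c ^ k * elem_sym k a"
  by (simp add: elem_sym_def prod.distrib sum_distrib_left)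

text \<open>Treats sine and cosine at once: \<open>c\<close> is the sign of \<open>w\<close> or 1.
  The eigenvalues for different \<open>w\<close> are permutations of each other, so a common factor
  comes out of the sum.\<close>

lemma diff_op_L_trig_sum:
  fixes m :: "int ^ 'n::{finite,linorder}" and f f' :: "real \<Rightarrow> real"
  assumes f: "\<And>t. (f has_real_derivative f' t) (at t)"
    and f': "\<And>t. (f' has_real_derivative - f t) (at t)"
    and g: "\<And>x. g x = (\<Sum>w | w permutes UNIV.
      c w * (\<Prod>j\<in>UNIV. f (2 * pi * of_int (m $ w j) * x $ j)))"
  shows "diff_op_L k g x = (- 4 * pi\<^sup>2) ^ k * elem_sym k (\<lambda>i. (of_int (m $ i))\<^sup>2) * g x"
proof -
  have *: "g = (\<lambda>x. \<Sum>w | w permutes UNIV.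
      c w * (\<Prod>j\<in>UNIV. (\<lambda>t. f (2 * pi * of_int (m $ w j) * t)) (x $ j)))"
    using g by auto
  let ?\<mu> = "\<lambda>w j. (- 4 * pi\<^sup>2) * (of_int (m $ w j))\<^sup>2"
  have "diff_op_L k g x = (\<Sum>w | w permutes UNIV. elem_sym k (?\<mu> w) *
      (c w * (\<Prod>j\<in>UNIV. f (2 * pi * of_int (m $ w j) * x $ j))))"
    unfolding *
  proof (rule diff_op_L_sum_prod)
    fix w :: "'n \<Rightarrow> 'n" and j t
    let ?b = "2 * pi * of_int (m $ w j) :: real"
    have lin: "((\<lambda>t. ?b * t) has_real_derivative ?b) (at t)"
      using DERIV_cmult_Id by blast
    show "((\<lambda>t. f (?b * t)) has_real_derivative ?b * f' (?b * t)) (at t)"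
      using DERIV_chain2[OF f lin] by (simp add: mult.commute)
    have "((\<lambda>t. ?b * f' (?b * t)) has_real_derivative ?b * (- f (?b * t) * ?b)) (at t)"
      by (intro DERIV_cmult DERIV_chain2[OF f' lin])
    then show "((\<lambda>t. ?b * f' (?b * t)) has_real_derivative ?\<mu> w j * f (?b * t)) (at t)"
      by (rule DERIV_cong) (simp add: power2_eq_square)
  qed
  also have "\<dots> = (\<Sum>w | w permutes UNIV. (- 4 * pi\<^sup>2) ^ k * elem_sym k (\<lambda>i. (of_int (m $ i))\<^sup>2) *
      (c w * (\<Prod>j\<in>UNIV. f (2 * pi * of_int (m $ w j) * x $ j))))"
    unfolding elem_sym_scale
    using elem_sym_permute[where a = "\<lambda>i. (of_int (m $ i))\<^sup>2"]
    by (intro sum.cong refl) simp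
  finally show ?thesis
    by (simp add: g sum_distrib_left)
qed

text \<open>The expansion in \<open>det_def\<close> permutes the column index, that is, the
  coordinates of \<open>x\<close>. Transposing first makes the permutation act on \<open>m\<close>,
  as in \<open>cos_plus\<close>.\<close>

lemma sin_minus_sum:
  "sin_minus m x = (\<Sum>w | w permutes UNIV.
    of_int (sign w) * (\<Prod>j\<in>UNIV. sin (2 * pi * of_int (m $ w j) * x $ j)))"
  unfolding sin_minus_def by (subst det_transpose[symmetric]) (simp add: det_def transpose_def)

section \<open>The Dirichlet condition\<close>

text \<open>The argument is an integer multiple of \<open>pi\<close> in both cases. This gives the
  zero columns of the determinant and also the symmetry of the cosines about 0 and 1/2.\<close>

lemma sin_int_half_period:
  fixes y :: real
  assumes "y = 0 \<or> y = 1 / 2"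
  shows "sin (2 * pi * of_int k * y) = 0"
proof -
  have "2 * pi * of_int k * (1 / 2) = of_int k * pi"
    by simp
  then have "sin (2 * pi * of_int k * (1 / 2)) = 0"
    by (metis sin_zero_iff_int2)
  then show ?thesis
    using assms by (metis mult_zero_right sin_zero)
qed

lemma dirichlet_sin_minus:
  fixes m :: "int ^ 'n::{finite,linorder}"
  shows "dirichlet (sin_minus m)"
  unfolding dirichlet_def frontier_fund_domain
proof safe
  fix x a :: "(real, 'n) vec" and b
  let ?A = "\<chi> i j. sin (2 * pi * of_int (m $ i) * x $ j)"
  assume ab: "(a, b) \<in> wall_equations" "x \<in> wall a b"
  have zero_column: "det ?A = 0" if "x $ j = 0 \<or> x $ j = 1 / 2" for j
  proof -
    have "row j (transpose ?A) = 0"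
      by (simp add: row_def transpose_def vec_eq_iff sin_int_half_period[OF that])
    then show ?thesis
      by (metis det_transpose det_zero_row(2))
  qed
  consider "x $ first_index = 1 / 2" | "x $ last_index = 0"
    | i j where "consecutive i j" "x $ i = x $ j"
    using ab by (auto simp: wall_equations_def wall_def inner_axis' inner_diff_left)
  then show "sin_minus m x = 0"
  proof cases
    case (3 i j)
    then have "i \<noteq> j" "column i ?A = column j ?A"
      by (auto simp: consecutive_def column_def vec_eq_iff)
    then show ?thesis
      unfolding sin_minus_def by (rule det_identical_columns)
  qed (auto simp: sin_minus_def intro: zero_column)
qed

section \<open>The Neumann condition\<close>

text \<open>Mirroring the argument turns a derivative \<open>D\<close> at 0 into \<open>- D\<close>,
  and derivatives are unique.\<close>

lemma has_derivative_zero_if_even: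
  fixes f :: "real \<Rightarrow> real"
  assumes "f differentiable at 0" and even: "\<And>t. f (- t) = f t"
  shows "(f has_real_derivative 0) (at 0)"
proof -
  obtain D where D: "(f has_real_derivative D) (at 0)"
    using assms(1) by (auto simp: real_differentiable_def)
  then have "(f has_real_derivative - D) (at 0)"
    using DERIV_mirror[of f D 0] unfolding even minus_zero by blast
  then have "D = - D"
    by (rule DERIV_unique[OF D])
  then have "D = 0"
    by linarith
  with D show ?thesis
    by (rule DERIV_cong)
qed

text \<open>Reordering the factors by \<open>p\<close> turns \<open>w\<close> into its composition
  with \<open>p\<close>, which again runs through all permutations. Used for the reflections that
  swap two coordinates.\<close>

lemma cos_plus_permute:
  fixes m :: "int ^ 'n::finite"
  assumes "p permutes UNIV"
  shows "cos_plus m (\<chi> j. x $ p j) = cos_plus m x"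
proof -
  have "cos_plus m x = (\<Sum>w | w permutes UNIV.
      \<Prod>j\<in>UNIV. cos (2 * pi * of_int (m $ w (p j)) * x $ p j))"
    unfolding cos_plus_def
    by (intro sum.cong refl prod.permute[OF assms, unfolded o_def])
  also have "\<dots> = cos_plus m (\<chi> j. x $ p j)"
    using sum_permutations_compose_right[OF assms,
        of "\<lambda>w. \<Prod>j\<in>UNIV. cos (2 * pi * of_int (m $ w j) * x $ p j)"]
    by (simp add: cos_plus_def)
  finally show ?thesis ..
qed

lemma neumann_cos_plus:
  fixes m :: "int ^ 'n::{finite,linorder}"
  shows "neumann (cos_plus m)"
  unfolding neumann_def
proof (intro ballI, clarify)
  fix x a :: "(real, 'n) vec" and b
  assume ab: "(a, b) \<in> wall_equations" "x \<in> wall a b"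
  \<comment> \<open>The two addition formulas differ only in the sign of a term containing the
    vanishing sine.\<close>
  have cos_int: "cos (2 * pi * of_int k * y - u) = cos (2 * pi * of_int k * y + u)"
    if "y = 0 \<or> y = 1 / 2" for k y u
    by (simp add: cos_add cos_diff sin_int_half_period[OF that])
  have axis_even: "cos_plus m (x - t *\<^sub>R axis i 1) = cos_plus m (x + t *\<^sub>R axis i 1)"
    if "x $ i = 0 \<or> x $ i = 1 / 2" for i t
    unfolding cos_plus_def
    by (intro sum.cong prod.cong)
      (auto simp: axis_def right_diff_distrib distrib_left cos_int[OF that])
  \<comment> \<open>As \<open>x\<close> lies on the hyperplane, the two points are mirror images in
    it.\<close>
  have even: "cos_plus m (x - t *\<^sub>R a) = cos_plus m (x + t *\<^sub>R a)" for t
  proof -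
    have ax: "a \<bullet> x = b"
      using ab(2) by (simp add: wall_def)
    consider i where "a = axis i 1" "b = 0 \<or> b = 1 / 2"
      | i j where "consecutive i j" "a = axis i 1 - axis j 1" "b = 0"
      using ab(1) unfolding wall_equations_def by blast
    then show ?thesis
    proof cases
      case (1 i)
      then have "x $ i = 0 \<or> x $ i = 1 / 2"
        using ax by (simp add: inner_axis')
      then show ?thesis
        unfolding \<open>a = axis i 1\<close> by (rule axis_even)
    next
      case (2 i j)
      then have "x $ i = x $ j"
        using ax by (simp add: inner_axis' inner_diff_left)
      moreover have "i \<noteq> j"
        using 2 by (auto simp: consecutive_def)
      \<comment> \<open>Reflection in this wall swaps coordinates \<open>i\<close> and
        \<open>j\<close>: from the common value at \<open>x\<close>, one moves by \<open>t\<close>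
        and the other by \<open>- t\<close>.\<close>
      ultimately have "(x - t *\<^sub>R a) $ l = (x + t *\<^sub>R a) $ Transposition.transpose i j l" for l
        unfolding 2(2)
        by (cases "l = i"; cases "l = j") (simp_all add: axis_def)
      then have "x - t *\<^sub>R a = (\<chi> l. (x + t *\<^sub>R a) $ Transposition.transpose i j l)"
        unfolding vec_eq_iff vec_lambda_beta by blast
      then show ?thesis
        by (simp only: cos_plus_permute permutes_swap_id UNIV_I)
    qed
  qed
  show "((\<lambda>t. cos_plus m (x + t *\<^sub>R sgn a)) has_real_derivative 0) (at 0)"
  proof (rule has_derivative_zero_if_even)
    have deriv: "((\<lambda>t. cos (c * (x + t *\<^sub>R sgn a) $ j)) has_real_derivative
        - sin (c * x $ j) * (c * sgn a $ j)) (at 0)" for c j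
      by (auto intro!: derivative_eq_intros)
    show "(\<lambda>t. cos_plus m (x + t *\<^sub>R sgn a)) differentiable at 0"
      unfolding cos_plus_def real_differentiable_def
      \<comment> \<open>Only existence of a derivative matters here, so its value is left to
        unification.\<close>
      by (rule exI, rule DERIV_sum, rule has_field_derivative_prod, rule deriv)
    show "cos_plus m (x + - t *\<^sub>R sgn a) = cos_plus m (x + t *\<^sub>R sgn a)" for t
      \<comment> \<open>Rescaling the parameter passes from the normal \<open>a\<close> to the unit
        normal \<open>sgn a\<close>.\<close>
      using even[of "t / norm a"] by (simp add: sgn_div_norm divide_inverse)
  qed
qed

theorem mainTheorem6:
  fixes m :: "int ^ 'n::{finite,linorder}"
  shows
    "((\<forall>k \<in> {1..CARD('n)}. \<forall>x \<in> fund_domain.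
        diff_op_L k (sin_minus m) x =
          (- 4 * pi\<^sup>2) ^ k * elem_sym k (\<lambda>i. (of_int (m $ i))\<^sup>2) * sin_minus m x)
      \<and> dirichlet (sin_minus m))
    \<and> ((\<forall>k \<in> {1..CARD('n)}. \<forall>x \<in> fund_domain.
        diff_op_L k (cos_plus m) x =
          (- 4 * pi\<^sup>2) ^ k * elem_sym k (\<lambda>i. (of_int (m $ i))\<^sup>2) * cos_plus m x)
      \<and> neumann (cos_plus m))"
proof (intro conjI ballI)
  show "diff_op_L k (sin_minus m) x =
      (- 4 * pi\<^sup>2) ^ k * elem_sym k (\<lambda>i. (of_int (m $ i))\<^sup>2) * sin_minus m x" for k x
    by (rule diff_op_L_trig_sum[OF DERIV_sin DERIV_cos sin_minus_sum])
  show "diff_op_L k (cos_plus m) x =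
      (- 4 * pi\<^sup>2) ^ k * elem_sym k (\<lambda>i. (of_int (m $ i))\<^sup>2) * cos_plus m x" for k x
  proof (rule diff_op_L_trig_sum)
    show "(cos has_real_derivative - sin t) (at t)"
      and "((\<lambda>t. - sin t) has_real_derivative - cos t) (at t)" for t :: real
      by (auto intro!: derivative_eq_intros)
    show "cos_plus m x = (\<Sum>w | w permutes UNIV.
        1 * (\<Prod>j\<in>UNIV. cos (2 * pi * of_int (m $ w j) * x $ j)))" for x
      by (simp add: cos_plus_def)
  qed
qed (rule dirichlet_sin_minus neumann_cos_plus)+

end
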